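(* For every integer $r\ge 2$ and every integer $n\ge 1$, \[ \frac{1}{r-1}\cdot n^{1/((r+1)2^{r-2})} \le L_r(n)\le \left\lceil n^{1/(2^r-1)}\right\rceil .\]
   Context: An ordered hypergraph is a hypergraph whose vertex set is equipped with a total order. An (ordered) $r$-matching is an ordered hypergraph in which every edge has exactly $r$ vertices and every vertex is contained in exactly one edge; its size is its number of edges. An $r$-pattern is an $r$-matching of size $2$ on the vertex set $\{1,\dots,2r\}$. For an $r$-pattern $P$, an $r$-matching is a $P$-clique if every pair of its edges (with the induced ordering on their $2r$ vertices) is order-isomorphic to $P$. For an $r$-matching $M$, $L_P(M)$ is the size of the largest $P$-clique contained in $M$ (formed by a subset of the edges of $M$), and $L(M)=\max_P L_P(M)$, the maximum being over all $r$-patterns $P$. $L_r(n)$ is the minimum value of $L(M)$ over all ordered $r$-matchings $M$ of size $n$. *)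

theory Defs
  imports Complex_Main
begin

text \<open>
  A hypergraph is a pair of a vertex set and an edge set.  It is ordered by the order of the
  class \<open>linorder\<close> on the type of its vertices.
\<close>

type_synonym 'a hypergraph = "'a set \<times> 'a set set"

abbreviation verts :: "'a hypergraph \<Rightarrow> 'a set" where "verts \<equiv> fst"
abbreviation edges :: "'a hypergraph \<Rightarrow> 'a set set" where "edges \<equiv> snd"

definition is_matching :: "nat \<Rightarrow> 'a::linorder hypergraph \<Rightarrow> bool" where
  "is_matching r M \<longleftrightarrow>
     finite (verts M) \<and>
     (\<forall>e\<in>edges M. e \<subseteq> verts M \<and> card e = r) \<and>
     (\<forall>v\<in>verts M. \<exists>!e. e \<in> edges M \<and> v \<in> e)"

definition msize :: "'a hypergraph \<Rightarrow> nat" where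
  "msize M = card (edges M)"

definition order_isomorphic ::
    "'a::linorder hypergraph \<Rightarrow> 'b::linorder hypergraph \<Rightarrow> bool" where
  "order_isomorphic G H \<longleftrightarrow>
     (\<exists>f. bij_betw f (verts G) (verts H) \<and> strict_mono_on (verts G) f \<and>
          (\<lambda>e. f ` e) ` edges G = edges H)"

definition is_pattern :: "nat \<Rightarrow> nat hypergraph \<Rightarrow> bool" where
  "is_pattern r P \<longleftrightarrow> is_matching r P \<and> msize P = 2 \<and> verts P = {1..2 * r}"

definition is_clique :: "nat \<Rightarrow> nat hypergraph \<Rightarrow> 'a::linorder hypergraph \<Rightarrow> bool" where
  "is_clique r P M \<longleftrightarrow>
     is_matching r M \<and>
     (\<forall>e\<in>edges M. \<forall>e'\<in>edges M. e \<noteq> e' \<longrightarrow> order_isomorphic (e \<union> e', {e, e'}) P)"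

definition spanned :: "'a set set \<Rightarrow> 'a hypergraph" where
  "spanned F = (\<Union>F, F)"

definition largest_P_clique ::
    "nat \<Rightarrow> nat hypergraph \<Rightarrow> 'a::linorder hypergraph \<Rightarrow> nat" where
  "largest_P_clique r P M =
     Max {msize (spanned F) | F. F \<subseteq> edges M \<and> is_clique r P (spanned F)}"

definition largest_clique :: "nat \<Rightarrow> 'a::linorder hypergraph \<Rightarrow> nat" where
  "largest_clique r M = Max {largest_P_clique r P M | P. is_pattern r P}"

text \<open>
  Only the order type of the vertex set matters, and every finite linear order is isomorphic to
  a finite set of natural numbers, so it is enough to let the vertices be natural numbers.
  On \<^typ>\<open>nat\<close>, \<^const>\<open>Inf\<close> of a nonempty set is its minimum.
\<close>

definition min_largest_clique :: "nat \<Rightarrow> nat \<Rightarrow> nat" where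
  "min_largest_clique r n =
     Inf {largest_clique r M | M :: nat hypergraph. is_matching r M \<and> msize M = n}"

end

theory Submission imports Defs "HOL-Library.FuncSet"
begin

text \<open>
  Write \<open>e\<^sub>0 < \<dots> < e\<^bsub>r-1\<^esub>\<close> for the vertices of an edge.  The relative position of two disjoint edges
  is the table of all comparisons \<open>e\<^sub>i < f\<^sub>j\<close>, where \<open>e\<close> is the edge with the smaller least
  vertex.  So \<open>L(M)\<close> is the size of the largest homogeneous set of edges, one in which all pairs
  have the same table (lemmas \<open>homogeneous_imp_clique\<close> and \<open>clique_imp_homogeneous\<close>).

  Lower bound.  For a pair \<open>e, f\<close> let \<open>A\<close> be the set of \<open>i \<ge> 1\<close> such that the coordinates
  \<open>i - 1\<close> and \<open>i\<close> order \<open>e\<close> and \<open>f\<close> in the same direction.  Each set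
  \<open>A \<subseteq> {1..<r}\<close> gives a partial order on the edges, and any two edges are comparable in one of
  these \<open>2\<^bsup>r-1\<^esup>\<close> orders.  Hence the number of edges is at most the product, over \<open>A\<close>, of the
  lengths of the longest chains.  In a chain for \<open>A\<close> the only freedom left between neighbouring
  coordinates is, for \<open>i \<in> A\<close>, whether the intervals \<open>[e\<^bsub>i-1\<^esub>, e\<^sub>i]\<close> and
  \<open>[f\<^bsub>i-1\<^esub>, f\<^sub>i]\<close> are disjoint or cross, and once disjoint they stay so when
  \<open>e\<close> and \<open>f\<close> are moved farther apart in the chain.  Sampling the chain at one of \<open>|A| + 1\<close> possible
  scales makes this choice constant: a chain with more than \<open>k\<^bsup>|A|+1\<^esup>\<close> elements contains
  \<open>k + 1\<close> elements for which it depends on \<open>i\<close> only (\<open>scale_selection\<close>).  Every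
  \<open>(r - 1)\<close>-st of these elements then form a homogeneous set: if the intervals are disjoint for
  all of \<open>i+1, \<dots>, j\<close>, walking \<open>j - i \<le> r - 1\<close> steps along the chain separates coordinates
  \<open>i\<close> and \<open>j\<close> (\<open>chain_contains_homogeneous\<close>).  With \<open>k = (r - 1) L(M)\<close> this bounds
  the number of edges by \<open>k\<close> to the power \<open>\<Sum>\<^sub>A (|A| + 1) = (r + 1) 2\<^bsup>r-2\<^esup>\<close>.

  Upper bound.  By induction on \<open>r\<close> there are \<open>m\<close> to the power \<open>2\<^sup>r - 1\<close> edges without a
  homogeneous set of more than \<open>m\<close> edges.  Take such a family for \<open>r\<close>, split the least vertex
  of each edge into two adjacent ones, and blow up every edge of the resulting \<open>(r+1)\<close>-matching
  into a family of edges in which each coordinate runs through an interval of its own.  Pairs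
  from the same and from different blown-up edges never have the same relative position, so a
  homogeneous set lives in one of the two levels.  On the inner level only the direction of each
  coordinate relative to the first varies, and an iterated lexicographic square, as in the
  extremal examples for the theorem of Erdos and Szekeres on monotone subsequences, has \<open>m\<close> to the power \<open>2\<^sup>r\<close> edges.
  Altogether this gives the exponent \<open>(2\<^sup>r - 1) + 2\<^sup>r = 2\<^bsup>r+1\<^esup> - 1\<close>.
\<close>

section \<open>Vertices of an edge in increasing order\<close>

definition vertex :: "'a::linorder set \<Rightarrow> nat \<Rightarrow> 'a" where
  "vertex e i = sorted_list_of_set e ! i"

lemma vertex_strict_mono:
  assumes "i < j" "j < card e"
  shows "vertex e i < vertex e j"
  using assms sorted_wrt_nth_less[OF strict_sorted_list_of_set[of e], of i j]
  by (simp add: vertex_def)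

lemma vertex_image:
  assumes "finite e"
  shows "vertex e ` {..<card e} = e"
proof -
  have "vertex e ` {..<card e} = set (sorted_list_of_set e)"
    by (force simp: vertex_def in_set_conv_nth image_iff)
  then show ?thesis using assms by simp
qed

lemma vertex_in:
  assumes "i < card e"
  shows "vertex e i \<in> e"
proof -
  have "finite e" using assms by (cases "finite e") auto
  from vertex_image[OF this] assms show ?thesis by blast
qed

lemma vertex_less_iff:
  assumes "i < card e" "j < card e"
  shows "vertex e i < vertex e j \<longleftrightarrow> i < j"
  using assms vertex_strict_mono[of i j e] vertex_strict_mono[of j i e]
  by (metis less_asym' linorder_neqE_nat order_less_irrefl)

lemma vertex_le_iff:
  assumes "i < card e" "j < card e"
  shows "vertex e i \<le> vertex e j \<longleftrightarrow> i \<le> j"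
  using vertex_less_iff[OF assms(2,1)] by (meson not_le)

lemma vertex_neq:
  assumes "e \<inter> f = {}" "i < card e" "j < card f"
  shows "vertex e i \<noteq> vertex f j"
  using assms vertex_in by (metis disjoint_iff)

lemma vertex_image_enum:
  fixes p :: "nat \<Rightarrow> 'a::linorder"
  assumes "\<And>i j. i < j \<Longrightarrow> j < r \<Longrightarrow> p i < p j" "k < r"
  shows "vertex (p ` {..<r}) k = p k"
proof -
  have "sorted_wrt (<) (map p [0..<r])"
    using assms(1) by (auto simp: sorted_wrt_iff_nth_less)
  then have "sorted_list_of_set (set (map p [0..<r])) = map p [0..<r]"
    by (intro sorted_list_of_set.idem_if_sorted_distinct) (auto simp: strict_sorted_iff)
  then show ?thesis using assms(2) by (simp add: vertex_def atLeast0LessThan)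
qed

lemma vertex_strict_mono_image:
  assumes "strict_mono_on e g" "i < card e"
  shows "vertex (g ` e) i = g (vertex e i)"
proof -
  have fin: "finite e" using assms(2) by (cases "finite e") auto
  have "g ` e = (\<lambda>i. g (vertex e i)) ` {..<card e}"
    using vertex_image[OF fin] by (metis image_image)
  moreover have "g (vertex e i) < g (vertex e j)" if "i < j" "j < card e" for i j
    using that assms(1) vertex_in[of i e] vertex_in[of j e] vertex_strict_mono[of i j e]
    by (auto simp: strict_mono_on_def)
  ultimately show ?thesis
    using vertex_image_enum[of "card e" "\<lambda>i. g (vertex e i)" i] assms(2) by simp
qed

section \<open>Cliques as homogeneous families\<close>

text \<open>
  Whether two edges have the relative position \<open>P\<close> is a question about an unordered pair.
  Listing first the edge with the smaller least vertex turns it into the table \<open>T\<close> of all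
  comparisons between the two edges.  The edges are given by an enumeration \<open>p\<close> of their
  vertices, so that the same notion serves for edges of a hypergraph (\<open>p = vertex\<close>) and for
  explicitly constructed ones.
\<close>

definition homogeneous :: "nat \<Rightarrow> ('x \<Rightarrow> nat \<Rightarrow> 'a::linorder) \<Rightarrow> 'x set \<Rightarrow> bool" where
  "homogeneous r p C \<longleftrightarrow>
     (\<exists>T. \<forall>x\<in>C. \<forall>y\<in>C. x \<noteq> y \<longrightarrow> p x 0 < p y 0 \<longrightarrow>
        (\<forall>i<r. \<forall>j<r. p x i < p y j \<longleftrightarrow> T i j))"

lemma is_matching_spanned_iff:
  assumes "0 < r"
  shows "is_matching r (spanned F) \<longleftrightarrow>
    finite (\<Union>F) \<and> (\<forall>e\<in>F. card e = r) \<and> pairwise disjnt F"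
proof -
  have "(\<forall>v\<in>\<Union>F. \<exists>!e. e \<in> F \<and> v \<in> e) \<longleftrightarrow>
      (\<forall>e\<in>F. \<forall>f\<in>F. \<forall>v. v \<in> e \<longrightarrow> v \<in> f \<longrightarrow> e = f)"
    by (auto simp: Ex1_def) metis+
  also have "\<dots> \<longleftrightarrow> pairwise disjnt F"
    by (auto simp: pairwise_def disjnt_iff)
  finally have "(\<forall>v\<in>\<Union>F. \<exists>!e. e \<in> F \<and> v \<in> e) \<longleftrightarrow> pairwise disjnt F" .
  then show ?thesis unfolding is_matching_def spanned_def by auto
qed

lemma is_matching_imp_spanned:
  assumes "is_matching r M" "0 < r"
  shows "is_matching r (spanned (edges M))"
proof -
  have "\<Union>(edges M) = verts M" using assms(1) unfolding is_matching_def by blast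
  then have "spanned (edges M) = M" by (cases M) (simp add: spanned_def)
  then show ?thesis using assms by simp
qed

lemma is_matching_spanned_mono:
  assumes "is_matching r (spanned F)" "0 < r" "F' \<subseteq> F"
  shows "is_matching r (spanned F')"
  using assms unfolding is_matching_spanned_iff[OF assms(2)]
  by (meson Union_mono finite_subset pairwise_mono subset_iff)

text \<open>
  Replacing each vertex of a union of two edges by its rank is the order isomorphism onto an
  \<open>r\<close>-pattern.  The rank of a vertex counts the vertices of its own edge up to it, and
  those of the other edge before it, so the pattern depends on the comparison table only.
\<close>

definition pattern_of :: "nat \<Rightarrow> (nat \<Rightarrow> nat \<Rightarrow> bool) \<Rightarrow> nat hypergraph" where
  "pattern_of r T = ({1..2 * r},
     {(\<lambda>i. Suc i + card {j. j < r \<and> \<not> T i j}) ` {..<r},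
      (\<lambda>j. Suc j + card {i. i < r \<and> T i j}) ` {..<r}})"

lemma rank_bij_betw:
  fixes U :: "'a::linorder set"
  assumes "finite U"
  defines "\<rho> \<equiv> \<lambda>x. card {y \<in> U. y \<le> x}"
  shows "strict_mono_on U \<rho>" "bij_betw \<rho> U {1..card U}"
proof -
  show mono: "strict_mono_on U \<rho>"
    unfolding strict_mono_on_def
  proof (intro allI impI)
    fix x y assume "x \<in> U \<and> y \<in> U \<and> x < y"
    then have "{z \<in> U. z \<le> x} \<subset> {z \<in> U. z \<le> y}" by force
    then show "\<rho> x < \<rho> y" unfolding \<rho>_def using assms(1) by (simp add: psubset_card_mono)
  qed
  then have inj: "inj_on \<rho> U" by (rule strict_mono_on_imp_inj_on)
  have "\<rho> x \<in> {1..card U}" if "x \<in> U" for x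
  proof -
    have "\<rho> x \<le> card U" unfolding \<rho>_def using assms(1) by (simp add: card_mono)
    moreover have "x \<in> {y \<in> U. y \<le> x}" using that by simp
    then have "0 < \<rho> x" unfolding \<rho>_def using assms(1) by (subst card_gt_0_iff) auto
    ultimately show ?thesis by simp
  qed
  then have "\<rho> ` U = {1..card U}"
    using inj by (intro card_subset_eq) (auto simp: card_image)
  with inj show "bij_betw \<rho> U {1..card U}" by (simp add: bij_betw_def)
qed

lemma rank_vertex:
  assumes "card e = r" "card f = r" "i < r" "e \<inter> f = {}"
  shows "card {y \<in> e \<union> f. y \<le> vertex e i} = Suc i + card {j. j < r \<and> vertex f j < vertex e i}"
proof -
  have fin: "finite e" "finite f" using assms by (auto intro: card_ge_0_finite)
  have inj: "inj_on (vertex g) A" if "A \<subseteq> {..<card g}" for g :: "'a set" and A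
    by (intro linorder_inj_onI) (use that vertex_strict_mono[of _ _ g] in \<open>force+\<close>)
  have "{y \<in> e. y \<le> vertex e i} = vertex e ` {j. j < r \<and> vertex e j \<le> vertex e i}"
    using vertex_image[OF fin(1)] assms(1) by auto
  moreover have "{j. j < r \<and> vertex e j \<le> vertex e i} = {..i}"
    using assms by (auto simp: vertex_le_iff)
  moreover have "card (vertex e ` {..i}) = Suc i"
    using assms by (subst card_image[OF inj]) auto
  ultimately have 1: "card {y \<in> e. y \<le> vertex e i} = Suc i" by metis
  have "{y \<in> f. y \<le> vertex e i} = {y \<in> f. y < vertex e i}"
    using assms vertex_in[of i e] by (auto simp: order.order_iff_strict)
  also have "\<dots> = vertex f ` {j. j < r \<and> vertex f j < vertex e i}"
    using vertex_image[OF fin(2)] assms(2) by auto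
  also have "card \<dots> = card {j. j < r \<and> vertex f j < vertex e i}"
    using assms by (intro card_image inj) auto
  finally have 2: "card {y \<in> f. y \<le> vertex e i} = card {j. j < r \<and> vertex f j < vertex e i}" .
  have "{y \<in> e \<union> f. y \<le> vertex e i} = {y \<in> e. y \<le> vertex e i} \<union> {y \<in> f. y \<le> vertex e i}"
    by auto
  then show ?thesis using 1 2 assms(4) fin
    by (simp add: card_Un_disjoint disjoint_iff)
qed

text \<open>
  One rank map yields both facts: it is an order isomorphism onto the pattern, and the pattern is
  an \<open>r\<close>-matching because it is the injective image of one.
\<close>

lemma order_isomorphic_pattern_of:
  assumes "card e = r" "card f = r" "0 < r" "e \<inter> f = {}"
    and T: "\<And>i j. i < r \<Longrightarrow> j < r \<Longrightarrow> vertex e i < vertex f j \<longleftrightarrow> T i j"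
  shows "order_isomorphic (e \<union> f, {e, f}) (pattern_of r T)"
    and "is_pattern r (pattern_of r T)"
proof -
  have fin: "finite e" "finite f" using assms by (auto intro: card_ge_0_finite)
  define \<rho> where "\<rho> x = card {y \<in> e \<union> f. y \<le> x}" for x
  have cU: "card (e \<union> f) = 2 * r" using assms fin by (simp add: card_Un_disjoint)
  note \<rho> = rank_bij_betw[of "e \<union> f", folded \<rho>_def, unfolded cU]
  have mono: "strict_mono_on (e \<union> f) \<rho>" and bij: "bij_betw \<rho> (e \<union> f) {1..2 * r}"
    using \<rho> fin by auto
  have "\<rho> (vertex e i) = Suc i + card {j. j < r \<and> \<not> T i j}" if "i < r" for i
  proof -
    have "{j. j < r \<and> vertex f j < vertex e i} = {j. j < r \<and> \<not> T i j}"
      using T[OF that] vertex_neq[of e f i] assms that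
      by (metis (no_types, opaque_lifting) linorder_neqE order_less_asym)
    then show ?thesis using rank_vertex[of e r f i] assms that by (simp add: \<rho>_def)
  qed
  then have e: "\<rho> ` e = (\<lambda>i. Suc i + card {j. j < r \<and> \<not> T i j}) ` {..<r}"
    using vertex_image[OF fin(1)] assms(1) by (metis (no_types, lifting) image_cong image_image lessThan_iff)
  have "\<rho> (vertex f j) = Suc j + card {i. i < r \<and> T i j}" if "j < r" for j
  proof -
    have "{i. i < r \<and> vertex e i < vertex f j} = {i. i < r \<and> T i j}"
      using T that by auto
    then show ?thesis using rank_vertex[of f r e j] assms that
      by (simp add: \<rho>_def Un_commute Int_commute)
  qed
  then have f: "\<rho> ` f = (\<lambda>j. Suc j + card {i. i < r \<and> T i j}) ` {..<r}"
    using vertex_image[OF fin(2)] assms(2) by (metis (no_types, lifting) image_cong image_image lessThan_iff)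
  have P: "pattern_of r T = ({1..2 * r}, {\<rho> ` e, \<rho> ` f})"
    unfolding pattern_of_def e f ..
  show "order_isomorphic (e \<union> f, {e, f}) (pattern_of r T)"
    unfolding order_isomorphic_def P using mono bij by auto
  have inj: "inj_on \<rho> (e \<union> f)" and im: "\<rho> ` e \<union> \<rho> ` f = {1..2 * r}"
    using bij by (auto simp: bij_betw_def image_Un)
  have dis: "\<rho> ` e \<inter> \<rho> ` f = {}"
    using inj assms(4) by (metis image_empty inj_on_image_Int sup_ge1 sup_ge2)
  have "card (\<rho> ` e) = r" "card (\<rho> ` f) = r"
    using inj assms by (auto simp: card_image inj_on_Un)
  moreover from this dis have "\<rho> ` e \<noteq> \<rho> ` f" using assms(3) by auto
  moreover have "spanned {\<rho> ` e, \<rho> ` f} = pattern_of r T" by (simp add: spanned_def P im)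
  ultimately show "is_pattern r (pattern_of r T)"
    using is_matching_spanned_iff[OF assms(3), of "{\<rho> ` e, \<rho> ` f}"] dis fin
    by (auto simp: is_pattern_def msize_def P pairwise_insert disjnt_def)
qed

lemma pattern_exists:
  assumes "0 < r"
  obtains P where "is_pattern r P"
proof
  show "is_pattern r (pattern_of r (\<lambda>i j. vertex {..<r} i < vertex {r..<2 * r} j))"
    by (rule order_isomorphic_pattern_of(2)[of "{..<r}" r "{r..<2 * r}"]) (use assms in auto)
qed

lemma homogeneous_imp_clique:
  assumes M: "is_matching r (spanned F)" and "0 < r" and hom: "homogeneous r vertex F"
  obtains P where "is_pattern r P" "is_clique r P (spanned F)"
proof -
  from M have card: "\<And>e. e \<in> F \<Longrightarrow> card e = r" and dis: "\<And>e f. e \<in> F \<Longrightarrow> f \<in> F \<Longrightarrow> e \<noteq> f \<Longrightarrow> e \<inter> f = {}"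
    by (auto simp: is_matching_spanned_iff[OF assms(2)] pairwise_def disjnt_def)
  from hom obtain T where T: "\<forall>e\<in>F. \<forall>f\<in>F. e \<noteq> f \<longrightarrow> vertex e 0 < vertex f 0 \<longrightarrow>
      (\<forall>i<r. \<forall>j<r. vertex e i < vertex f j \<longleftrightarrow> T i j)"
    unfolding homogeneous_def ..
  have iso: "order_isomorphic (e \<union> f, {e, f}) (pattern_of r T) \<and> is_pattern r (pattern_of r T)"
    if "e \<in> F" "f \<in> F" "e \<noteq> f" for e f
  proof -
    have *: "order_isomorphic (e \<union> f, {e, f}) (pattern_of r T) \<and> is_pattern r (pattern_of r T)"
      if "e \<in> F" "f \<in> F" "e \<noteq> f" "vertex e 0 < vertex f 0" for e f
      using order_isomorphic_pattern_of[of e r f T] card dis T that \<open>0 < r\<close> by auto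
    have "vertex e 0 < vertex f 0 \<or> vertex f 0 < vertex e 0"
      using vertex_neq[of e f 0 0] card dis that \<open>0 < r\<close> by (auto simp: neq_iff)
    then show ?thesis using *[of e f] *[of f e] that
      by (auto simp: insert_commute Un_commute)
  qed
  show thesis
    \<comment> \<open>A table read off from no pair at all need not come from a pattern.\<close>
  proof (cases "\<exists>e\<in>F. \<exists>f\<in>F. e \<noteq> f")
    case True
    with iso M show thesis by (intro that[of "pattern_of r T"]) (auto simp: is_clique_def spanned_def)
  next
    case False
    obtain P where "is_pattern r P" using pattern_exists[OF \<open>0 < r\<close>] .
    with False M show thesis by (intro that[of P]) (auto simp: is_clique_def spanned_def)
  qed
qed

text \<open>
  An order isomorphism maps the edge with the smaller least vertex to the edge with the smaller
  least vertex, so the comparison table can be read off from the pattern.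
\<close>

lemma clique_imp_homogeneous:
  assumes "is_clique r P (spanned F)" "0 < r"
  shows "homogeneous r vertex F"
proof -
  define T where "T i j \<longleftrightarrow> (\<exists>a\<in>edges P. \<exists>b\<in>edges P. vertex a 0 < vertex b 0 \<and> vertex a i < vertex b j)" for i j
  have T: "vertex e i < vertex f j \<longleftrightarrow> T i j"
    if ef: "e \<in> F" "f \<in> F" "e \<noteq> f" and less: "vertex e 0 < vertex f 0" and ij: "i < r" "j < r" for e f i j
  proof -
    have card: "card e = r" "card f = r"
      using assms ef by (auto simp: is_clique_def is_matching_spanned_iff)
    from assms(1) ef have "order_isomorphic (e \<union> f, {e, f}) P"
      by (auto simp: is_clique_def spanned_def)
    then obtain g where mono: "strict_mono_on (e \<union> f) g" and P: "edges P = {g ` e, g ` f}"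
      by (auto simp: order_isomorphic_def)
    have "strict_mono_on e g" "strict_mono_on f g"
      using mono by (auto simp: strict_mono_on_def)
    then have v: "vertex (g ` e) k = g (vertex e k)" "vertex (g ` f) k = g (vertex f k)" if "k < r" for k
      using vertex_strict_mono_image[of e g k] vertex_strict_mono_image[of f g k] card that by auto
    have g: "g (vertex e k) < g (vertex f l) \<longleftrightarrow> vertex e k < vertex f l" if "k < r" "l < r" for k l
      using vertex_in[of k e] vertex_in[of l f] card that
      by (intro strict_mono_on_less[OF mono]) auto
    show ?thesis
      unfolding T_def P using v g[OF ij] g[OF \<open>0 < r\<close> \<open>0 < r\<close>] ij less \<open>0 < r\<close>
      by (simp add: order_less_imp_not_less)
  qed
  show ?thesis
    unfolding homogeneous_def by (rule exI[of _ T]) (use T in simp)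
qed

lemma largest_P_clique_set:
  fixes M :: "'a::linorder hypergraph"
  assumes "finite (edges M)"
  shows "finite {msize (spanned F) |F. F \<subseteq> edges M \<and> is_clique r P (spanned F)}"
    "0 \<in> {msize (spanned F) |F. F \<subseteq> edges M \<and> is_clique r P (spanned F)}"
proof -
  have "{msize (spanned F) |F. F \<subseteq> edges M \<and> is_clique r P (spanned F)} \<subseteq> (\<lambda>F. msize (spanned F)) ` Pow (edges M)"
    by auto
  then show "finite {msize (spanned F) |F. F \<subseteq> edges M \<and> is_clique r P (spanned F)}"
    by (rule finite_subset) (use assms in auto)
  have "is_clique r P (spanned ({} :: 'a set set))" by (auto simp: is_clique_def is_matching_def spanned_def)
  moreover have "msize (spanned ({} :: 'a set set)) = 0" by (simp add: msize_def spanned_def)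
  ultimately show "0 \<in> {msize (spanned F) |F. F \<subseteq> edges M \<and> is_clique r P (spanned F)}"
    by (metis (mono_tags, lifting) empty_subsetI mem_Collect_eq)
qed

lemma finite_patterns: "finite {P. is_pattern r P}"
proof (rule finite_subset)
  show "{P. is_pattern r P} \<subseteq> {{1..2 * r}} \<times> Pow (Pow {1..2 * r})"
    by (fastforce simp: is_pattern_def is_matching_def mem_Times_iff)
qed auto

lemma finite_edges:
  assumes "is_matching r M"
  shows "finite (edges M)"
  using assms by (intro finite_subset[of "edges M" "Pow (verts M)"]) (auto simp: is_matching_def)

text \<open>
  The next two lemmas say that \<^const>\<open>largest_clique\<close> is the maximal size of a homogeneous set of
  edges.  Both bounds are proved in these terms, without reference to patterns.
\<close>

lemma card_homogeneous_le_largest_clique: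
  assumes M: "is_matching r M" and "0 < r" and F: "F \<subseteq> edges M" "homogeneous r vertex F"
  shows "card F \<le> largest_clique r M"
proof -
  have largest: "largest_clique r M = Max ((\<lambda>P. largest_P_clique r P M) ` {P. is_pattern r P})"
    unfolding largest_clique_def setcompr_eq_image ..
  have "is_matching r (spanned F)"
    using is_matching_spanned_mono is_matching_imp_spanned M F \<open>0 < r\<close> by metis
  then obtain P where P: "is_pattern r P" "is_clique r P (spanned F)"
    using homogeneous_imp_clique F(2) \<open>0 < r\<close> by metis
  have "card F = msize (spanned F)" by (simp add: msize_def spanned_def)
  also have "\<dots> \<le> largest_P_clique r P M"
    unfolding largest_P_clique_def
    by (rule Max_ge) (use largest_P_clique_set finite_edges[OF M] F(1) P(2) in auto)
  also have "\<dots> \<le> largest_clique r M"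
    unfolding largest by (rule Max_ge) (use P(1) finite_patterns[of r] in auto)
  finally show ?thesis .
qed

lemma largest_clique_le:
  assumes M: "is_matching r M" and "0 < r"
    and le: "\<And>F. F \<subseteq> edges M \<Longrightarrow> homogeneous r vertex F \<Longrightarrow> card F \<le> m"
  shows "largest_clique r M \<le> m"
proof -
  have "largest_P_clique r P M \<le> m" for P
    unfolding largest_P_clique_def
  proof (rule Max.boundedI)
    fix a assume "a \<in> {msize (spanned F) |F. F \<subseteq> edges M \<and> is_clique r P (spanned F)}"
    then obtain F where F: "a = card F" "F \<subseteq> edges M" "is_clique r P (spanned F)"
      by (auto simp: msize_def spanned_def)
    then show "a \<le> m" using le[OF F(2) clique_imp_homogeneous[OF F(3) \<open>0 < r\<close>]] by simp
  qed (use largest_P_clique_set[OF finite_edges[OF M], of r P] in blast)+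
  moreover have "{P. is_pattern r P} \<noteq> {}" using pattern_exists[OF \<open>0 < r\<close>] by blast
  ultimately show ?thesis
    unfolding largest_clique_def setcompr_eq_image using finite_patterns[of r]
    by (intro Max.boundedI) auto
qed

section \<open>Chains in several orders\<close>

text \<open>
  Mirsky's labelling: label \<open>x\<close> by the lengths of the longest chains ending just before
  \<open>x\<close>, one for each of the orders.  Two elements comparable in an order get different labels in
  that coordinate, so the labelling is injective.
\<close>

lemma card_le_prod_chain_bounds:
  assumes "finite I"
    and trans: "\<And>a x y z. a \<in> I \<Longrightarrow> R a x y \<Longrightarrow> R a y z \<Longrightarrow> R a x z"
    and comparable: "\<And>x y. x \<in> X \<Longrightarrow> y \<in> X \<Longrightarrow> x \<noteq> y \<Longrightarrow> \<exists>a\<in>I. R a x y \<or> R a y x"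
    and bound: "\<And>a xs. a \<in> I \<Longrightarrow> set xs \<subseteq> X \<Longrightarrow> sorted_wrt (R a) xs \<Longrightarrow> length xs \<le> b a"
  shows "card X \<le> (\<Prod>a\<in>I. b a)"
proof -
  define S where "S a x = {xs. set xs \<subseteq> X \<and> sorted_wrt (R a) (xs @ [x])}" for a x
  define h where "h a x = Max (length ` S a x)" for a x
  have less: "length ` S a x \<subseteq> {..<b a}" if "a \<in> I" "x \<in> X" for a x
  proof (clarsimp simp: S_def)
    fix xs assume "set xs \<subseteq> X" "sorted_wrt (R a) (xs @ [x])"
    then show "length xs < b a" using bound[OF \<open>a \<in> I\<close>, of "xs @ [x]"] \<open>x \<in> X\<close> by simp
  qed
  have fin: "finite (length ` S a x)" if "a \<in> I" "x \<in> X" for a x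
    using less[OF that] by (rule finite_subset) simp
  have h: "h a x \<in> length ` S a x" if "a \<in> I" "x \<in> X" for a x
    unfolding h_def
  proof (rule Max_in[OF fin[OF that]])
    have "[] \<in> S a x" by (simp add: S_def)
    then show "length ` S a x \<noteq> {}" by blast
  qed
  have mono: "h a x < h a y" if "a \<in> I" "x \<in> X" "y \<in> X" "R a x y" for a x y
  proof -
    from h[OF that(1,2)] obtain xs where xs: "xs \<in> S a x" "length xs = h a x" by auto
    then have "xs @ [x] \<in> S a y"
      using that trans[OF that(1) _ that(4)] by (auto simp: S_def sorted_wrt_append)
    then have "length (xs @ [x]) \<le> h a y"
      unfolding h_def using fin[OF that(1,3)] by (intro Max_ge) blast+
    with xs show ?thesis by simp
  qed
  define \<phi> where "\<phi> x = (\<lambda>a\<in>I. h a x)" for x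
  have "\<phi> ` X \<subseteq> (\<Pi>\<^sub>E a\<in>I. {..<b a})"
    using h less by (force simp: \<phi>_def)
  moreover have "inj_on \<phi> X"
  proof (rule inj_onI, rule ccontr)
    fix x y assume xy: "x \<in> X" "y \<in> X" "\<phi> x = \<phi> y" "x \<noteq> y"
    then obtain a where a: "a \<in> I" "R a x y \<or> R a y x" using comparable by blast
    then have "h a x \<noteq> h a y" using mono[of a x y] mono[of a y x] xy by auto
    moreover have "h a x = h a y" using xy(3) a(1) by (metis \<phi>_def restrict_apply')
    ultimately show False by simp
  qed
  moreover have "finite (\<Pi>\<^sub>E a\<in>I. {..<b a})" using assms(1) by (intro finite_PiE) auto
  ultimately have "card X \<le> card (\<Pi>\<^sub>E a\<in>I. {..<b a})" by (metis card_image card_mono)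
  then show ?thesis using assms(1) by (simp add: card_PiE)
qed

section \<open>Choosing a scale\<close>

text \<open>
  Let each relation \<open>D i\<close> on positions persist when the pair of positions is spread apart.
  Cut a window of length \<open>k\<^bsup>u+1\<^esup>\<close>, where \<open>u = |U|\<close>, into \<open>k\<close> windows of length \<open>k\<^sup>u\<close>.  If every
  \<open>D i\<close> holds between the ends of each of the smaller windows, these ends can be selected.
  Otherwise some \<open>D i\<close> fails between the ends of a smaller window, hence everywhere inside it;
  so \<open>i\<close> is settled there, and the induction goes on in this window with \<open>u - 1\<close> relations.
  Neighbouring windows share an end, which is why lengths rather than cardinalities are counted.
\<close>

lemma scale_selection:
  fixes D :: "'i \<Rightarrow> nat \<Rightarrow> nat \<Rightarrow> bool"
  assumes "finite U"
    and "\<And>i j j' l' l. i \<in> U \<Longrightarrow> j \<le> j' \<Longrightarrow> j' \<le> l' \<Longrightarrow> l' \<le> l \<Longrightarrow> l \<le> a + k ^ Suc (card U) \<Longrightarrow>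
           D i j' l' \<Longrightarrow> D i j l"
  shows "\<exists>t B. (\<forall>u\<le>k. a \<le> t u \<and> t u \<le> a + k ^ Suc (card U)) \<and>
           (\<forall>u v. u < v \<longrightarrow> v \<le> k \<longrightarrow> t u < t v) \<and>
           (\<forall>i\<in>U. \<forall>u v. u < v \<longrightarrow> v \<le> k \<longrightarrow> (D i (t u) (t v) \<longleftrightarrow> i \<in> B))"
  using assms
proof (induction "card U" arbitrary: U a)
  case 0
  then have "U = {}" by simp
  then show ?case by (intro exI[of _ "\<lambda>u. a + u"] exI[of _ "{}"]) auto
next
  case (Suc n)
  define t where "t u = a + u * k ^ Suc n" for u
  have t_le: "t u \<le> a + k ^ Suc (card U)" if "u \<le> k" for u
    using that Suc(2) mult_le_mono1[of u k "k ^ Suc n"] by (simp add: t_def)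
  have t_mono: "t u \<le> t v" if "u \<le> v" for u v
    using that by (auto simp: t_def intro: mult_le_mono1)
  show ?case
  proof (cases "\<exists>i\<in>U. \<exists>u<k. \<not> D i (t u) (t (Suc u))")
    case False
    have "t u < t v" if "u < v" "v \<le> k" for u v
    proof -
      have "0 < k ^ Suc n" using that by simp
      then show ?thesis unfolding t_def using that(1) by (simp only: add_less_cancel_left mult_less_cancel2)
    qed
    moreover have "D i (t u) (t v)" if "i \<in> U" "u < v" "v \<le> k" for i u v
      using Suc.prems(2)[of i "t u" "t u" "t (Suc u)" "t v"] False that t_le t_mono by auto
    ultimately show ?thesis
      using t_le by (intro exI[of _ t] exI[of _ U]) (auto simp: t_def)
  next
    case True
    then obtain i\<^sub>0 u\<^sub>0 where i0: "i\<^sub>0 \<in> U" "u\<^sub>0 < k" "\<not> D i\<^sub>0 (t u\<^sub>0) (t (Suc u\<^sub>0))" by auto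
    define U' where "U' = U - {i\<^sub>0}"
    have card: "card U' = n" using Suc(2) i0 Suc.prems(1) by (simp add: U'_def)
    have end': "t u\<^sub>0 + k ^ Suc (card U') = t (Suc u\<^sub>0)" by (simp add: card t_def)
    have le: "t (Suc u\<^sub>0) \<le> a + k ^ Suc (card U)" using t_le i0 by simp
    have "\<exists>t' B. (\<forall>u\<le>k. t u\<^sub>0 \<le> t' u \<and> t' u \<le> t u\<^sub>0 + k ^ Suc (card U')) \<and>
           (\<forall>u v. u < v \<longrightarrow> v \<le> k \<longrightarrow> t' u < t' v) \<and>
           (\<forall>i\<in>U'. \<forall>u v. u < v \<longrightarrow> v \<le> k \<longrightarrow> (D i (t' u) (t' v) \<longleftrightarrow> i \<in> B))"
    proof (rule Suc.hyps(1))
      fix i j j' l' l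
      assume *: "i \<in> U'" "j \<le> j'" "j' \<le> l'" "l' \<le> l" "l \<le> t u\<^sub>0 + k ^ Suc (card U')" "D i j' l'"
      from this(5) le have "l \<le> a + k ^ Suc (card U)" unfolding end' by simp
      with * show "D i j l" using Suc.prems(2)[of i j j' l' l] by (auto simp: U'_def)
    qed (use card Suc.prems(1) in \<open>auto simp: U'_def\<close>)
    then obtain t' B where
      t': "\<forall>u\<le>k. t u\<^sub>0 \<le> t' u \<and> t' u \<le> t (Suc u\<^sub>0)" "\<forall>u v. u < v \<longrightarrow> v \<le> k \<longrightarrow> t' u < t' v"
      and B: "\<forall>i\<in>U'. \<forall>u v. u < v \<longrightarrow> v \<le> k \<longrightarrow> (D i (t' u) (t' v) \<longleftrightarrow> i \<in> B)"
      unfolding end' by blast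
    have not_D: "\<not> D i\<^sub>0 (t' u) (t' v)" if "u < v" "v \<le> k" for u v
    proof
      assume "D i\<^sub>0 (t' u) (t' v)"
      moreover have "t u\<^sub>0 \<le> t' u" "t' u \<le> t' v" "t' v \<le> t (Suc u\<^sub>0)" using that t' by (auto simp: less_imp_le)
      ultimately have "D i\<^sub>0 (t u\<^sub>0) (t (Suc u\<^sub>0))" using Suc.prems(2) i0(1) le by blast
      then show False using i0 by simp
    qed
    have "a \<le> t u\<^sub>0" by (simp add: t_def)
    then have "\<forall>u\<le>k. a \<le> t' u \<and> t' u \<le> a + k ^ Suc (card U)"
      using t'(1) le by (meson order_trans)
    moreover have "\<forall>i\<in>U. \<forall>u v. u < v \<longrightarrow> v \<le> k \<longrightarrow> (D i (t' u) (t' v) \<longleftrightarrow> i \<in> B - {i\<^sub>0})"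
      using B not_D by (auto simp: U'_def)
    ultimately show ?thesis using t'(2) by blast
  qed
qed

section \<open>Lower bound\<close>

text \<open>
  A pattern of directions, one for each coordinate, is encoded by the set \<open>A\<close> of coordinates that
  have the same direction as their predecessor.  The exponent in the bound for chains is then
  \<open>|A| + 1\<close>.  The first coordinate is always increasing, since a pair is listed starting with
  the smaller least vertex.
\<close>

primrec direction :: "nat set \<Rightarrow> nat \<Rightarrow> bool" where
  "direction A 0 \<longleftrightarrow> True"
| "direction A (Suc i) \<longleftrightarrow> (direction A i \<longleftrightarrow> Suc i \<in> A)"

definition signed_less ::
    "nat \<Rightarrow> ('x \<Rightarrow> nat \<Rightarrow> 'a::linorder) \<Rightarrow> nat set \<Rightarrow> 'x \<Rightarrow> 'x \<Rightarrow> bool" where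
  "signed_less r p A x y \<longleftrightarrow>
     (\<forall>i<r. if direction A i then p x i < p y i else p y i < p x i)"

lemma signed_less_trans:
  assumes "signed_less r p A x y" "signed_less r p A y z"
  shows "signed_less r p A x z"
  using assms unfolding signed_less_def by (metis order_less_trans)

lemma signed_less_comparable:
  assumes "p x 0 < p y 0" and neq: "\<And>i. i < r \<Longrightarrow> p x i \<noteq> p y i"
  shows "\<exists>A\<in>Pow {1..<r}. signed_less r p A x y"
proof -
  define A where "A = {i \<in> {1..<r}. (p x (i - 1) < p y (i - 1)) = (p x i < p y i)}"
  have "direction A i \<longleftrightarrow> p x i < p y i" if "i < r" for i
    using that by (induction i) (use assms(1) in \<open>auto simp: A_def\<close>)
  then have "signed_less r p A x y"
    unfolding signed_less_def using neq by (metis linorder_neqE)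
  moreover have "A \<in> Pow {1..<r}" by (auto simp: A_def)
  ultimately show ?thesis by blast
qed

text \<open>
  Choose a subsequence of the chain with \<open>scale_selection\<close>, and let \<open>B\<close> contain the coordinates
  at which the intervals between \<open>i - 1\<close> and \<open>i\<close> became disjoint.
  Between neighbouring coordinates \<open>i - 1\<close> and \<open>i\<close> of two elements of the subsequence there
  are two cases.  For \<open>i \<notin> A \<inter> B\<close> both vertices at coordinate \<open>i - 1\<close> precede both at
  coordinate \<open>i\<close>; this decides every comparison between coordinates on different sides of \<open>i\<close>.
  For \<open>i \<in> A \<inter> B\<close> the two intervals are disjoint.  In a run of such \<open>i\<close> the
  first and last coordinates of two neighbours in the subsequence may still be in either order, but each
  step along it compensates for one coordinate.  Since a run spans at most \<open>r - 1\<close> steps,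
  it suffices to keep every \<open>(r - 1)\<close>-st element.
\<close>

lemma chain_contains_homogeneous:
  fixes p :: "'x \<Rightarrow> nat \<Rightarrow> 'a::linorder"
  assumes r: "2 \<le> r" and A: "A \<subseteq> {1..<r}"
    and incr: "\<And>x i j. x \<in> X \<Longrightarrow> i < j \<Longrightarrow> j < r \<Longrightarrow> p x i < p x j"
    and neq: "\<And>x y i j. x \<in> X \<Longrightarrow> y \<in> X \<Longrightarrow> x \<noteq> y \<Longrightarrow> i < r \<Longrightarrow> j < r \<Longrightarrow> p x i \<noteq> p y j"
    and xs: "set xs \<subseteq> X" "sorted_wrt (signed_less r p A) xs"
    and long: "((r - 1) * L) ^ Suc (card A) < length xs"
  shows "\<exists>C\<subseteq>X. card C = Suc L \<and> homogeneous r p C"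
proof -
  define k where "k = (r - 1) * L"
  define D where "D i j l \<longleftrightarrow> (if direction A i then p (xs ! j) i < p (xs ! l) (i - 1)
      else p (xs ! l) i < p (xs ! j) (i - 1))" for i j l
  have lt: "signed_less r p A (xs ! j) (xs ! l)" if "j < l" "l < length xs" for j l
    using xs(2) that by (rule sorted_wrt_nth_less)
  have le: "if direction A i then p (xs ! j) i \<le> p (xs ! l) i else p (xs ! l) i \<le> p (xs ! j) i"
    if "j \<le> l" "l < length xs" "i < r" for i j l
    using lt[of j l] that by (cases "j = l") (auto simp: signed_less_def less_imp_le split: if_splits)
  have dir_pred: "direction A (i - 1) = direction A i" if "i \<in> A" for i
    using that A by (cases i) auto
  have incr_le: "p x i \<le> p x j" if "x \<in> X" "i \<le> j" "j < r" for x i j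
    using incr[of x i j] that by (cases "i = j") (auto simp: less_imp_le)
  have "\<exists>t B. (\<forall>u\<le>k. 0 \<le> t u \<and> t u \<le> 0 + k ^ Suc (card A)) \<and>
           (\<forall>u v. u < v \<longrightarrow> v \<le> k \<longrightarrow> t u < t v) \<and>
           (\<forall>i\<in>A. \<forall>u v. u < v \<longrightarrow> v \<le> k \<longrightarrow> (D i (t u) (t v) \<longleftrightarrow> i \<in> B))"
  proof (rule scale_selection)
    show "finite A" using A by (rule finite_subset) simp
    fix i j j' l' l
    assume *: "i \<in> A" "j \<le> j'" "j' \<le> l'" "l' \<le> l" "l \<le> 0 + k ^ Suc (card A)" "D i j' l'"
    have "l < length xs" using * long by (simp add: k_def)
    moreover have "i < r" using * A by auto
    ultimately show "D i j l"
      using \<open>i < r\<close>[THEN less_imp_diff_less, of 1] le[of j j' i] le[of l' l "i - 1"] le[of j j' "i - 1"] le[of l' l i] * dir_pred[OF *(1)]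
      unfolding D_def by (auto split: if_splits)
  qed
  then obtain t B where tB: "\<forall>u\<le>k. 0 \<le> t u \<and> t u \<le> 0 + k ^ Suc (card A)"
      "\<forall>u v. u < v \<longrightarrow> v \<le> k \<longrightarrow> t u < t v"
      "\<forall>i\<in>A. \<forall>u v. u < v \<longrightarrow> v \<le> k \<longrightarrow> (D i (t u) (t v) \<longleftrightarrow> i \<in> B)"
    by blast
  have t: "u \<le> k \<Longrightarrow> t u \<le> k ^ Suc (card A)" "u < v \<Longrightarrow> v \<le> k \<Longrightarrow> t u < t v" for u v
    using tB(1,2) by auto
  have B: "D i (t u) (t v) \<longleftrightarrow> i \<in> B" if "i \<in> A" "u < v" "v \<le> k" for i u v
    using tB(3) that by blast
  define d where "d u = xs ! t u" for u
  have t_len: "t u < length xs" if "u \<le> k" for u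
    using t(1)[OF that] long by (simp add: k_def)
  have d_in: "d u \<in> X" if "u \<le> k" for u
    using t_len[OF that] xs(1) by (auto simp: d_def)
  have d_lt: "signed_less r p A (d u) (d v)" if "u < v" "v \<le> k" for u v
    unfolding d_def using t(2) t_len that by (intro lt) auto
  have d_le: "if direction A i then p (d u) i \<le> p (d v) i else p (d v) i \<le> p (d u) i"
    if "u \<le> v" "v \<le> k" "i < r" for i u v
    using d_lt[of u v] that by (cases "u = v") (auto simp: signed_less_def less_imp_le split: if_splits)
  have d_neq: "d u \<noteq> d v" if "u < v" "v \<le> k" for u v
    using d_lt[OF that, unfolded signed_less_def, rule_format, of 0] r by auto
  have d_vneq: "p (d u) i \<noteq> p (d v) j" if "u < v" "v \<le> k" "i < r" "j < r" for u v i j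
    using neq[of "d u" "d v" i j] d_in d_neq that by auto

  \<comment> \<open>For \<open>i \<notin> A\<close> the directions at \<open>i - 1\<close> and \<open>i\<close> are opposite, so one interval is nested in the other.\<close>
  have crossing: "p (d u) (i - 1) < p (d v) i \<and> p (d v) (i - 1) < p (d u) i"
    if "0 < i" "i < r" "i \<notin> A \<inter> B" "u < v" "v \<le> k" for i u v
  proof -
    have s: "if direction A i then p (d u) i < p (d v) i else p (d v) i < p (d u) i"
      "if direction A (i - 1) then p (d u) (i - 1) < p (d v) (i - 1) else p (d v) (i - 1) < p (d u) (i - 1)"
      using d_lt[OF that(4,5)] that by (auto simp: signed_less_def)
    have inc: "p (d u) (i - 1) < p (d u) i" "p (d v) (i - 1) < p (d v) i"
      using incr d_in that by auto
    show ?thesis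
    proof (cases "i \<in> A")
      case True
      then have "\<not> D i (t u) (t v)" using B that by auto
      then have nd: "if direction A i then p (d v) (i - 1) \<le> p (d u) i else p (d u) (i - 1) \<le> p (d v) i"
        unfolding D_def d_def by (auto split: if_splits)
      moreover have "p (d u) i \<noteq> p (d v) (i - 1)" "p (d u) (i - 1) \<noteq> p (d v) i"
        using d_vneq that by auto
      ultimately show ?thesis using s inc dir_pred[OF True] by (auto split: if_splits)
    next
      case False
      then have "direction A i \<noteq> direction A (i - 1)" using that(1) by (cases i) auto
      then show ?thesis using s inc by (auto split: if_splits)
    qed
  qed
  have disjoint: "if direction A i then p (d u) i < p (d v) (i - 1) else p (d v) i < p (d u) (i - 1)"
    if "i \<in> A \<inter> B" "u < v" "v \<le> k" for i u v
    using B that unfolding D_def d_def by blast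

  have dir_run: "direction A j = direction A i" if "{i<..j} \<subseteq> A" "i \<le> j" for i j
    using that(2,1)
  proof (induction j rule: dec_induct)
    case (step j)
    then have "Suc j \<in> A" "{i<..j} \<subseteq> A" by auto
    with step show ?case by auto
  qed simp
  have run: "if direction A i then p (d u) j \<le> p (d v) i else p (d v) j \<le> p (d u) i"
    if "{i<..j} \<subseteq> A \<inter> B" "i \<le> j" "j < r" "u + (j - i) \<le> v" "v \<le> k" for i j u v
    using that(2,1,3-)
  proof (induction j arbitrary: u v rule: dec_induct)
    case base
    then show ?case using d_le[of u v i] by simp
  next
    case (step j)
    have j: "Suc j \<in> A \<inter> B" using step by auto
    have dir: "direction A (Suc j) = direction A i" using dir_run[of i "Suc j"] step by auto
    have sub: "{i<..j} \<subseteq> A \<inter> B" using step.prems(1) by auto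
    have uv: "u < v" "Suc u + (j - i) \<le> v" "u + (j - i) \<le> v - 1" using step by auto
    show ?case
    proof (cases "direction A i")
      case True
      have "p (d u) (Suc j) < p (d (Suc u)) j"
        using disjoint[OF j, of u "Suc u"] True dir uv step.prems by simp
      also have "\<dots> \<le> p (d v) i"
        using step.IH[OF sub, of "Suc u" v] True uv step.prems by simp
      finally show ?thesis using True by simp
    next
      case False
      have "p (d v) (Suc j) < p (d (v - 1)) j"
        using disjoint[OF j, of "v - 1" v] False dir uv step.prems by simp
      also have "\<dots> \<le> p (d u) i"
        using step.IH[OF sub, of u "v - 1"] False uv step.prems by simp
      finally show ?thesis using False by simp
    qed
  qed

  define T where "T i j \<longleftrightarrow>
    (if i \<le> j then direction A i \<or> \<not> {i<..j} \<subseteq> A \<inter> B else direction A i \<and> {j<..i} \<subseteq> A \<inter> B)" for i j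
  have T: "p (d u) i < p (d v) j \<longleftrightarrow> T i j"
    if "u + (r - 1) \<le> v" "u < v" "v \<le> k" "i < r" "j < r" for u v i j
  proof -
    have s: "if direction A l then p (d u) l < p (d v) l else p (d v) l < p (d u) l" if "l < r" for l
      using d_lt[of u v] \<open>u < v\<close> \<open>v \<le> k\<close> that by (auto simp: signed_less_def)
    have inX: "d u \<in> X" "d v \<in> X" using d_in that by auto
    consider (up) "i \<le> j" "{i<..j} \<subseteq> A \<inter> B" | (up_sep) "i \<le> j" "\<not> {i<..j} \<subseteq> A \<inter> B"
      | (down) "j < i" "{j<..i} \<subseteq> A \<inter> B" | (down_sep) "j < i" "\<not> {j<..i} \<subseteq> A \<inter> B"
      by linarith
    then show ?thesis
    proof cases
      case up
      have *: "if direction A i then p (d u) j \<le> p (d v) i else p (d v) j \<le> p (d u) i"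
        using up that by (intro run) auto
      show ?thesis
      proof (cases "direction A i")
        case True
        then have "p (d u) i < p (d v) i" using s that by auto
        also have "\<dots> \<le> p (d v) j" using incr_le inX up that by auto
        finally show ?thesis using True up by (simp add: T_def)
      next
        case False
        then show ?thesis using * up by (auto simp: T_def)
      qed
    next
      case up_sep
      then obtain l where "l \<in> {i<..j}" and l: "l \<notin> A \<inter> B" by blast
      then have l: "i < l" "l \<le> j" "l \<notin> A \<inter> B" by auto
      have "p (d u) i \<le> p (d u) (l - 1)" using incr_le inX l that by auto
      also have "\<dots> < p (d v) l" using crossing[of l u v] l that by auto
      also have "\<dots> \<le> p (d v) j" using incr_le inX l that by auto
      finally show ?thesis using up_sep by (simp add: T_def)
    next
      case down
      have *: "if direction A j then p (d u) i \<le> p (d v) j else p (d v) i \<le> p (d u) j"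
        using down that by (intro run) auto
      have dir: "direction A i = direction A j" using dir_run[of j i] down by auto
      show ?thesis
      proof (cases "direction A i")
        case True
        then show ?thesis using * dir down d_vneq[of u v i j] that by (auto simp: T_def)
      next
        case False
        have "p (d v) j < p (d v) i" using incr inX down that by auto
        also have "\<dots> < p (d u) i" using s[of i] False that by auto
        finally show ?thesis using False down by (auto simp: T_def)
      qed
    next
      case down_sep
      then obtain l where "l \<in> {j<..i}" and l: "l \<notin> A \<inter> B" by blast
      then have l: "j < l" "l \<le> i" "l \<notin> A \<inter> B" by auto
      have "p (d v) j \<le> p (d v) (l - 1)" using incr_le inX l that by auto
      also have "\<dots> < p (d u) l" using crossing[of l u v] l that by auto
      also have "\<dots> \<le> p (d u) i" using incr_le inX l that by auto
      finally show ?thesis using down_sep by (auto simp: T_def)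
    qed
  qed

  define w where "w v = d ((r - 1) * v)" for v
  have w: "(r - 1) * u + (r - 1) \<le> (r - 1) * v" "(r - 1) * v \<le> k" if "u < v" "v \<le> L" for u v
  proof -
    show "(r - 1) * u + (r - 1) \<le> (r - 1) * v"
      using mult_le_mono2[of "Suc u" v "r - 1"] that by simp
    show "(r - 1) * v \<le> k" using that by (simp add: k_def)
  qed
  have T_w: "p (w u) i < p (w v) j \<longleftrightarrow> T i j" if "u < v" "v \<le> L" "i < r" "j < r" for u v i j
  proof -
    have "(r - 1) * u < (r - 1) * v" using w(1)[OF that(1,2)] r by linarith
    then show ?thesis unfolding w_def using w[OF that(1,2)] that by (intro T) auto
  qed
  have w_less: "p (w u) 0 < p (w v) 0" if "u < v" "v \<le> L" for u v
    using T_w[OF that, of 0 0] r by (simp add: T_def)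
  have "inj_on w {..L}"
  proof (rule linorder_inj_onI)
    fix u v assume "u < v" "v \<in> {..L}"
    then show "w u \<noteq> w v" using w_less[of u v] by auto
  qed auto
  then have "card (w ` {..L}) = Suc L" by (simp add: card_image)
  moreover have "homogeneous r p (w ` {..L})"
    unfolding homogeneous_def
  proof (intro exI[of _ T] ballI impI allI)
    fix x y i j assume *: "x \<in> w ` {..L}" "y \<in> w ` {..L}" "x \<noteq> y" "p x 0 < p y 0" "i < r" "j < r"
    then obtain u v where uv: "u \<le> L" "v \<le> L" "x = w u" "y = w v" by auto
    then have "u < v" using * w_less[of v u] by (metis linorder_neqE_nat order_less_asym)
    then show "p x i < p y j \<longleftrightarrow> T i j" using T_w[of u v i j] uv * by simp
  qed
  moreover have "w ` {..L} \<subseteq> X"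
    unfolding w_def k_def by (auto intro!: d_in simp: k_def)
  ultimately show ?thesis by blast
qed

lemma sum_Suc_card_Pow:
  assumes "finite X"
  shows "2 * (\<Sum>A\<in>Pow X. Suc (card A)) = (card X + 2) * 2 ^ card X"
  using assms
proof (induction X rule: finite_induct)
  case (insert x X)
  have "(\<Sum>A\<in>insert x ` Pow X. Suc (card A)) = (\<Sum>A\<in>Pow X. Suc (card (insert x A)))"
    by (rule sum.reindex_cong[OF _ refl refl]) (use insert in \<open>auto simp: inj_on_def\<close>)
  also have "\<dots> = (\<Sum>A\<in>Pow X. Suc (card A) + 1)"
  proof (rule sum.cong[OF refl])
    fix A assume "A \<in> Pow X"
    with insert have "finite A" "x \<notin> A" by (auto intro: finite_subset)
    then show "Suc (card (insert x A)) = Suc (card A) + 1" by simp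
  qed
  also have "\<dots> = (\<Sum>A\<in>Pow X. Suc (card A)) + 2 ^ card X"
    using insert by (simp only: sum.distrib) (simp add: card_Pow)
  finally have "(\<Sum>A\<in>Pow (insert x X). Suc (card A)) = 2 * (\<Sum>A\<in>Pow X. Suc (card A)) + 2 ^ card X"
    using insert unfolding Pow_insert by (subst sum.union_disjoint) auto
  then show ?case using insert by (simp add: algebra_simps)
qed simp

text \<open>
  Put \<open>L = L(M)\<close> and \<open>k = (r - 1) L\<close>.  There is no homogeneous set of \<open>L + 1\<close> edges, so the
  chains for \<open>A\<close> have at most \<open>k\<^bsup>|A|+1\<^esup>\<close> elements, and multiplying over \<open>A\<close> adds up
  the exponents.
\<close>

lemma msize_le_largest_clique_power:
  assumes M: "is_matching r M" and r: "2 \<le> r"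
  shows "msize M \<le> ((r - 1) * largest_clique r M) ^ ((r + 1) * 2 ^ (r - 2))"
proof -
  define L where "L = largest_clique r M"
  define k where "k = (r - 1) * L"
  have "is_matching r (spanned (edges M))" using is_matching_imp_spanned[OF M] r by simp
  then have card: "\<And>e. e \<in> edges M \<Longrightarrow> card e = r"
    and dis: "\<And>e f. e \<in> edges M \<Longrightarrow> f \<in> edges M \<Longrightarrow> e \<noteq> f \<Longrightarrow> e \<inter> f = {}"
    using r by (auto simp: is_matching_spanned_iff pairwise_def disjnt_def)
  have neq: "vertex e i \<noteq> vertex f j"
    if "e \<in> edges M" "f \<in> edges M" "e \<noteq> f" "i < r" "j < r" for e f i j
    using vertex_neq[of e f i j] card dis that by simp
  have "card (edges M) \<le> (\<Prod>A\<in>Pow {1..<r}. k ^ Suc (card A))"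
  proof (rule card_le_prod_chain_bounds[where R = "signed_less r vertex"])
    fix e f assume ef: "e \<in> edges M" "f \<in> edges M" "e \<noteq> f"
    then have "vertex e 0 < vertex f 0 \<or> vertex f 0 < vertex e 0"
      using neq[of e f 0 0] r by (auto simp: neq_iff)
    then show "\<exists>A\<in>Pow {1..<r}. signed_less r vertex A e f \<or> signed_less r vertex A f e"
    proof
      assume "vertex e 0 < vertex f 0"
      then show ?thesis using signed_less_comparable[of vertex e f r] neq ef by blast
    next
      assume "vertex f 0 < vertex e 0"
      then show ?thesis using signed_less_comparable[of vertex f e r] neq ef by blast
    qed
  next
    fix A xs assume *: "A \<in> Pow {1..<r}" "set xs \<subseteq> edges M" "sorted_wrt (signed_less r vertex A) xs"
    show "length xs \<le> k ^ Suc (card A)"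
    proof (rule ccontr)
      assume "\<not> ?thesis"
      then have "\<exists>C\<subseteq>edges M. card C = Suc L \<and> homogeneous r vertex C"
        using * r neq card unfolding k_def
        by (intro chain_contains_homogeneous[of r A "edges M" vertex xs L]) (auto intro: vertex_strict_mono)
      then show False
        using card_homogeneous_le_largest_clique[OF M] r unfolding L_def
        by (metis Suc_n_not_le_n less_le_trans pos2)
    qed
  qed (auto intro: signed_less_trans)
  also have "\<dots> = k ^ (\<Sum>A\<in>Pow {1..<r}. Suc (card A))" by (rule power_sum[symmetric])
  also have "(\<Sum>A\<in>Pow {1..<r}. Suc (card A)) = (r + 1) * 2 ^ (r - 2)"
  proof -
    have "2 * (\<Sum>A\<in>Pow {1..<r}. Suc (card A)) = (r + 1) * 2 ^ (r - 1)"
      using sum_Suc_card_Pow[of "{1..<r}"] r by simp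
    also have "\<dots> = 2 * ((r + 1) * 2 ^ (r - 2))"
    proof -
      from r obtain s where "r = s + 2" by (metis le_add_diff_inverse2)
      then show ?thesis by simp
    qed
    finally show ?thesis by simp
  qed
  finally show ?thesis unfolding msize_def k_def L_def .
qed

section \<open>Upper bound\<close>

lemma lex_less_iff:
  fixes a a' b b' N :: nat
  assumes "b < N" "b' < N"
  shows "a * N + b < a' * N + b' \<longleftrightarrow> a < a' \<or> a = a' \<and> b < b'"
proof -
  have *: "a * N + b < a' * N + b'" if "a < a'" "b < N" for a a' b b' :: nat
    using that mult_le_mono1[of "Suc a" a' N] by simp
  show ?thesis using *[of a a' b b'] *[of a' a b' b] assms by (metis add_less_cancel_left nat_neq_iff order_less_asym')
qed

lemma lex_eq_iff:
  fixes a a' b b' N :: nat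
  assumes "b < N" "b' < N"
  shows "a * N + b = a' * N + b' \<longleftrightarrow> a = a' \<and> b = b'"
  using lex_less_iff[OF assms, of a a'] lex_less_iff[OF assms(2,1), of a' a]
  by (metis nat_neq_iff)

lemma div_mod_eq_imp_eq:
  fixes z z' N :: nat
  assumes "z div N = z' div N" "z mod N = z' mod N"
  shows "z = z'"
  using assms by (metis div_mult_mod_eq)

lemma card_le_by_div:
  fixes N :: nat
  assumes "C \<subseteq> {..<K * N}" "\<And>x y. x \<in> C \<Longrightarrow> y \<in> C \<Longrightarrow> x \<noteq> y \<Longrightarrow> x div N \<noteq> y div N"
    and "(\<lambda>z. z div N) ` C \<subseteq> {..<K} \<Longrightarrow> card ((\<lambda>z. z div N) ` C) \<le> m"
  shows "card C \<le> m"
proof -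
  have "inj_on (\<lambda>z. z div N) C" using assms(2) by (meson inj_onI)
  moreover have "(\<lambda>z. z div N) ` C \<subseteq> {..<K}"
    using assms(1) by (auto simp: less_mult_imp_div_less)
  ultimately show ?thesis using assms(3) card_image by metis
qed

lemma card_le_by_mod:
  fixes N :: nat
  assumes "C \<subseteq> {..<K * N}" "\<And>x y. x \<in> C \<Longrightarrow> y \<in> C \<Longrightarrow> x div N = y div N"
    and "(\<lambda>z. z mod N) ` C \<subseteq> {..<N} \<Longrightarrow> card ((\<lambda>z. z mod N) ` C) \<le> m"
  shows "card C \<le> m"
proof -
  have "inj_on (\<lambda>z. z mod N) C" using assms(2) div_mod_eq_imp_eq by (meson inj_onI)
  moreover have "(\<lambda>z. z mod N) ` C \<subseteq> {..<N}"
    using assms(1) by (cases "N = 0") auto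
  ultimately show ?thesis using assms(3) card_image by metis
qed

text \<open>
  The inner level of the construction: \<open>r + 1\<close> linear orders on \<open>m\<close> to the power \<open>2\<^sup>r\<close> points,
  such that no more than \<open>m\<close> points are pairwise ordered in the same way relative to the first
  order.  For one more order, take the square of the set of points, with a pair \<open>(a, b)\<close> encoded as
  \<open>a N + b\<close>.  The old orders become lexicographic squares, and the new one agrees with the first
  order on \<open>a\<close> and reverses it on \<open>b\<close>.  Comparing the new order with the first one thus tells
  whether two points differ in \<open>a\<close>, and a homogeneous set maps injectively to one of the factors.
\<close>

lemma signed_grid:
  "\<exists>q :: nat \<Rightarrow> nat \<Rightarrow> nat.
     (\<forall>i\<le>r. \<forall>y<m ^ 2 ^ r. q y i < m ^ 2 ^ r) \<and>
     (\<forall>i\<le>r. inj_on (\<lambda>y. q y i) {..<m ^ 2 ^ r}) \<and>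
     (\<forall>C T. C \<subseteq> {..<m ^ 2 ^ r} \<longrightarrow>
        (\<forall>x\<in>C. \<forall>y\<in>C. q x 0 < q y 0 \<longrightarrow> (\<forall>i\<le>r. q x i < q y i \<longleftrightarrow> T i)) \<longrightarrow> card C \<le> m)"
proof (induction r)
  case 0
  have "card C \<le> m" if "C \<subseteq> {..<m}" for C
    using card_mono[OF _ that] by simp
  then show ?case by (intro exI[of _ "\<lambda>y i. y"]) auto
next
  case (Suc r)
  define N where "N = m ^ 2 ^ r"
  have N2: "m ^ 2 ^ Suc r = N * N"
    by (simp add: N_def power_add[symmetric] mult_2[symmetric] del: power_add)
  obtain q :: "nat \<Rightarrow> nat \<Rightarrow> nat" where q:
    "\<forall>i\<le>r. \<forall>y<N. q y i < N" "\<forall>i\<le>r. inj_on (\<lambda>y. q y i) {..<N}"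
    "\<forall>C T. C \<subseteq> {..<N} \<longrightarrow>
        (\<forall>x\<in>C. \<forall>y\<in>C. q x 0 < q y 0 \<longrightarrow> (\<forall>i\<le>r. q x i < q y i \<longleftrightarrow> T i)) \<longrightarrow> card C \<le> m"
    using Suc unfolding N_def by blast
  have q_less: "q y i < N" if "i \<le> r" "y < N" for i y
    using q(1) that by blast
  have q_inj: "x = y" if "i \<le> r" "x < N" "y < N" "q x i = q y i" for i x y
    using q(2) that by (auto dest: inj_onD)
  have q_card: "card C \<le> m" if "C \<subseteq> {..<N}"
    "\<And>x y i. x \<in> C \<Longrightarrow> y \<in> C \<Longrightarrow> q x 0 < q y 0 \<Longrightarrow> i \<le> r \<Longrightarrow> q x i < q y i \<longleftrightarrow> T i" for C T
    using q(3)[rule_format, OF that(1), of T] that(2) by blast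
  \<comment> \<open>For the new order \<open>r + 1\<close>: \<open>h\<close> chooses the order used on \<open>a\<close>, and \<open>s\<close> gives the position of \<open>b\<close>.\<close>
  define s where "s b i = (if i \<le> r then q b i else N - 1 - q b 0)" for b i
  define h where "h i = (if i \<le> r then i else 0)" for i
  define q' where "q' y i = q (y div N) (h i) * N + s (y mod N) i" for y i
  have dm: "y div N < N" "y mod N < N" if "y < N * N" for y
    using that by (cases "N = 0", auto simp: less_mult_imp_div_less)+
  have h: "h i \<le> r" for i by (simp add: h_def)
  have s_less: "s b i < N" if "b < N" for b i
    using q_less that by (auto simp: s_def)
  have s_inj: "b = b'" if "b < N" "b' < N" "s b i = s b' i" for b b' i
    using that q_inj[of i b b'] q_inj[of 0 b b'] q_less[of 0 b] q_less[of 0 b']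
    by (auto simp: s_def split: if_splits)
  have q'_less_iff: "q' x i < q' y j \<longleftrightarrow>
      q (x div N) (h i) < q (y div N) (h j) \<or>
      q (x div N) (h i) = q (y div N) (h j) \<and> s (x mod N) i < s (y mod N) j"
    if "x < N * N" "y < N * N" for x y i j
    unfolding q'_def using lex_less_iff s_less dm that by simp
  have 1: "q' y i < N * N" if "y < N * N" for y i
  proof -
    have "q' y i < N * N + 0"
      unfolding q'_def using lex_less_iff[of "s (y mod N) i" N 0 "q (y div N) (h i)" N]
        s_less q_less[OF h] dm[OF that] by (metis gr_zeroI not_less_zero)
    then show ?thesis by simp
  qed
  have 2: "x = y" if "x < N * N" "y < N * N" "q' x i = q' y i" for x y i
  proof -
    have "q (x div N) (h i) = q (y div N) (h i) \<and> s (x mod N) i = s (y mod N) i"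
      using that(3) lex_eq_iff s_less dm that(1,2) unfolding q'_def by metis
    then have "x div N = y div N" "x mod N = y mod N"
      using q_inj[OF h] s_inj dm that by blast+
    then show ?thesis by (rule div_mod_eq_imp_eq)
  qed
  have 3: "card C \<le> m"
    if C: "C \<subseteq> {..<N * N}" and
      T: "\<And>x y i. x \<in> C \<Longrightarrow> y \<in> C \<Longrightarrow> q' x 0 < q' y 0 \<Longrightarrow> i \<le> Suc r \<Longrightarrow> q' x i < q' y i \<longleftrightarrow> T i" for C T
  proof -
    have less: "x < N * N" if "x \<in> C" for x using C that by auto
    have flip: "\<not> s b (Suc r) < s b' (Suc r)" if "q b 0 < q b' 0" for b b'
      using that by (auto simp: s_def)
    show ?thesis
    proof (cases "T (Suc r)")
      case True
      have same: "\<not> q (x mod N) 0 < q (y mod N) 0" if "x \<in> C" "y \<in> C" "x div N = y div N" for x y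
      proof
        assume *: "q (x mod N) 0 < q (y mod N) 0"
        then have "q' x 0 < q' y 0" using that less by (simp add: q'_less_iff s_def)
        then have "q' x (Suc r) < q' y (Suc r)" using T[of x y "Suc r"] that True by simp
        then show False using that less flip[OF *] by (simp add: q'_less_iff)
      qed
      show ?thesis
      proof (rule card_le_by_div[OF C])
        fix x y assume xy: "x \<in> C" "y \<in> C" "x \<noteq> y"
        show "x div N \<noteq> y div N"
        proof
          assume eq: "x div N = y div N"
          then have "q (x mod N) 0 = q (y mod N) 0" using same xy by (metis linorder_neqE)
          then have "x mod N = y mod N" using q_inj dm less xy by blast
          then show False using eq xy div_mod_eq_imp_eq by blast
        qed
      next
        assume sub: "(\<lambda>z. z div N) ` C \<subseteq> {..<N}"
        show "card ((\<lambda>z. z div N) ` C) \<le> m"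
        proof (rule q_card[OF sub])
          fix a b i assume ab: "a \<in> (\<lambda>z. z div N) ` C" "b \<in> (\<lambda>z. z div N) ` C" "q a 0 < q b 0" "i \<le> r"
          then obtain x y where xy: "x \<in> C" "y \<in> C" "a = x div N" "b = y div N" by auto
          have "q' x 0 < q' y 0" using xy ab less by (simp add: q'_less_iff h_def)
          then have "q' x i < q' y i \<longleftrightarrow> T i" using T[of x y i] xy ab by simp
          moreover have "a \<noteq> b" "a < N" "b < N" using ab sub by auto
          then have "q a i \<noteq> q b i" using q_inj[OF \<open>i \<le> r\<close>] by blast
          ultimately show "q a i < q b i \<longleftrightarrow> T i"
            using xy ab less by (simp add: q'_less_iff h_def)
        qed
      qed
    next
      case False
      have same: "\<not> q (x div N) 0 < q (y div N) 0" if "x \<in> C" "y \<in> C" for x y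
      proof
        assume *: "q (x div N) 0 < q (y div N) 0"
        then have "q' x 0 < q' y 0" "q' x (Suc r) < q' y (Suc r)"
          using that less by (auto simp: q'_less_iff h_def)
        then show False using T[of x y "Suc r"] that False by simp
      qed
      have eq: "x div N = y div N" if "x \<in> C" "y \<in> C" for x y
        using same q_inj[of 0] dm less that by (metis le0 linorder_neqE)
      show ?thesis
      proof (rule card_le_by_mod[OF C eq])
        assume sub: "(\<lambda>z. z mod N) ` C \<subseteq> {..<N}"
        show "card ((\<lambda>z. z mod N) ` C) \<le> m"
        proof (rule q_card[OF sub])
          fix a b i assume ab: "a \<in> (\<lambda>z. z mod N) ` C" "b \<in> (\<lambda>z. z mod N) ` C" "q a 0 < q b 0" "i \<le> r"
          then obtain x y where xy: "x \<in> C" "y \<in> C" "a = x mod N" "b = y mod N" by auto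
          have "q' x 0 < q' y 0" using xy ab less eq[of x y] by (simp add: q'_less_iff s_def)
          then have "q' x i < q' y i \<longleftrightarrow> T i" using T[of x y i] xy ab by simp
          then show "q a i < q b i \<longleftrightarrow> T i"
            using xy ab less eq[of x y] by (simp add: q'_less_iff s_def)
        qed
      qed
    qed
  qed
  show ?case
    unfolding N2
    by (intro exI[of _ q'] conjI allI impI inj_onI) (use 1 2 3 in \<open>auto 0 3\<close>)
qed

text \<open>
  An edge of the outer family (\<open>p\<close>, with \<open>r\<close> vertices) and a point of the inner grid (\<open>q\<close>, with
  \<open>r + 1\<close> orders) are combined into an edge with \<open>r + 1\<close> vertices.  Each outer vertex becomes a
  block of \<open>2 N\<close> positions; the least one takes coordinates \<open>0\<close> and \<open>1\<close>, in the lower and upper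
  half of its block.  For edges with different outer edges the coordinates \<open>0\<close> and \<open>1\<close> of one
  precede coordinate \<open>0\<close> of the other; for edges with the same outer edge they do not.  So the
  entry \<open>T 1 0\<close> of the comparison table tells which of the two projections is injective on a
  homogeneous set.
\<close>

lemma extremal_family:
  assumes "1 \<le> r"
  shows "\<exists>p :: nat \<Rightarrow> nat \<Rightarrow> nat.
     (\<forall>x<m ^ (2 ^ r - 1). \<forall>i j. i < j \<longrightarrow> j < r \<longrightarrow> p x i < p x j) \<and>
     (\<forall>x<m ^ (2 ^ r - 1). \<forall>y<m ^ (2 ^ r - 1). \<forall>i<r. \<forall>j<r. p x i = p y j \<longrightarrow> x = y) \<and>
     (\<forall>C\<subseteq>{..<m ^ (2 ^ r - 1)}. homogeneous r p C \<longrightarrow> card C \<le> m)"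
  using assms
proof (induction r rule: nat_induct_at_least)
  case base
  have "card C \<le> m" if "C \<subseteq> {..<m}" for C
    using card_mono[OF _ that] by simp
  then show ?case by (intro exI[of _ "\<lambda>y i. y"]) auto
next
  case (Suc r)
  define K where "K = m ^ (2 ^ r - 1)"
  define N where "N = m ^ 2 ^ r"
  have KN: "m ^ (2 ^ Suc r - 1) = K * N"
  proof -
    have "2 ^ Suc r - 1 = (2 ^ r - 1) + (2 ^ r :: nat)" by simp
    then show ?thesis unfolding K_def N_def by (simp only: power_add)
  qed
  obtain p :: "nat \<Rightarrow> nat \<Rightarrow> nat" where p:
    "\<forall>x<K. \<forall>i j. i < j \<longrightarrow> j < r \<longrightarrow> p x i < p x j"
    "\<forall>x<K. \<forall>y<K. \<forall>i<r. \<forall>j<r. p x i = p y j \<longrightarrow> x = y"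
    "\<forall>C\<subseteq>{..<K}. homogeneous r p C \<longrightarrow> card C \<le> m"
    using Suc.IH unfolding K_def by blast
  have p_mono: "p x i < p x j" if "x < K" "i < j" "j < r" for x i j
    using p(1) that by blast
  have p_inj: "x = y" if "x < K" "y < K" "i < r" "j < r" "p x i = p y j" for x y i j
    using p(2) that by blast
  have p_card: "card C \<le> m" if "C \<subseteq> {..<K}" "homogeneous r p C" for C
    using p(3) that by blast
  obtain q :: "nat \<Rightarrow> nat \<Rightarrow> nat" where q:
    "\<forall>i\<le>r. \<forall>y<N. q y i < N" "\<forall>i\<le>r. inj_on (\<lambda>y. q y i) {..<N}"
    "\<forall>C T. C \<subseteq> {..<N} \<longrightarrow>
        (\<forall>x\<in>C. \<forall>y\<in>C. q x 0 < q y 0 \<longrightarrow> (\<forall>i\<le>r. q x i < q y i \<longleftrightarrow> T i)) \<longrightarrow> card C \<le> m"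
    using signed_grid[of r m] unfolding N_def by blast
  have q_less: "q y i < N" if "i \<le> r" "y < N" for i y
    using q(1) that by blast
  have q_inj: "x = y" if "i \<le> r" "x < N" "y < N" "q x i = q y i" for i x y
    using q(2) that by (auto dest: inj_onD)
  have q_card: "card C \<le> m" if "C \<subseteq> {..<N}"
    "\<And>x y i. x \<in> C \<Longrightarrow> y \<in> C \<Longrightarrow> q x 0 < q y 0 \<Longrightarrow> i \<le> r \<Longrightarrow> q x i < q y i \<longleftrightarrow> T i" for C T
    using q(3)[rule_format, OF that(1), of T] that(2) by blast
  define s where "s b i = (if i = 0 then 0 else N) + q b i" for b i
  define p' where "p' z i = p (z div N) (i - 1) * (2 * N) + s (z mod N) i" for z i
  have dm: "z div N < K" "z mod N < N" if "z < K * N" for z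
    using that by (cases "N = 0", auto simp: less_mult_imp_div_less)+
  have s_less: "s b i < 2 * N" if "b < N" "i \<le> r" for b i
    using q_less[OF that(2,1)] by (auto simp: s_def)
  have p'_less_iff: "p' x i < p' y j \<longleftrightarrow>
      p (x div N) (i - 1) < p (y div N) (j - 1) \<or>
      p (x div N) (i - 1) = p (y div N) (j - 1) \<and> s (x mod N) i < s (y mod N) j"
    if "x < K * N" "y < K * N" "i \<le> r" "j \<le> r" for x y i j
    unfolding p'_def using lex_less_iff s_less dm that by simp
  have 1: "p' z i < p' z j" if "z < K * N" "i < j" "j < Suc r" for z i j
  proof (cases "i = 0 \<and> j = 1")
    case True
    then show ?thesis using that Suc.hyps q_less[of 0 "z mod N"] dm[OF that(1)]
      by (simp add: p'_less_iff s_def)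
  next
    case False
    then have "i - 1 < j - 1" "j - 1 < r" using that by auto
    then show ?thesis using that p_mono[OF dm(1)] by (simp add: p'_less_iff)
  qed
  have 2: "x = y" if "x < K * N" "y < K * N" "i < Suc r" "j < Suc r" "p' x i = p' y j" for x y i j
  proof -
    have eq: "p (x div N) (i - 1) = p (y div N) (j - 1)" "s (x mod N) i = s (y mod N) j"
      using that(5) lex_eq_iff[OF s_less s_less, of "x mod N" i "y mod N" j] dm that(1-4)
      unfolding p'_def by auto
    have lt: "i - 1 < r" "j - 1 < r" using that Suc.hyps by auto
    have d: "x div N = y div N" using p_inj[OF _ _ lt eq(1)] dm that by simp
    then have "i - 1 = j - 1" using p_mono[of "x div N"] dm[OF that(1)] lt eq(1)
      by (metis less_irrefl linorder_neqE_nat)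
    moreover have "(i = 0) = (j = 0)"
      using eq(2) q_less[of i "x mod N"] q_less[of j "y mod N"] dm that
      by (auto simp: s_def split: if_splits)
    ultimately have "i = j" by auto
    then have "q (x mod N) i = q (y mod N) i" using eq(2) by (simp add: s_def)
    then have "x mod N = y mod N" using q_inj[of i] dm that by simp
    with d show ?thesis by (rule div_mod_eq_imp_eq)
  qed
  have 3: "card C \<le> m" if C: "C \<subseteq> {..<K * N}" and hom: "homogeneous (Suc r) p' C" for C
  proof -
    have less: "x < K * N" if "x \<in> C" for x using C that by auto
    obtain T where "\<forall>x\<in>C. \<forall>y\<in>C. x \<noteq> y \<longrightarrow> p' x 0 < p' y 0 \<longrightarrow>
        (\<forall>i<Suc r. \<forall>j<Suc r. p' x i < p' y j \<longleftrightarrow> T i j)"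
      using hom unfolding homogeneous_def ..
    then have T: "p' x i < p' y j \<longleftrightarrow> T i j"
      if "x \<in> C" "y \<in> C" "p' x 0 < p' y 0" "i < Suc r" "j < Suc r" for x y i j
      using that by (metis less_irrefl)
    show ?thesis
    proof (cases "T 1 0")
      case True
      have same: "\<not> q (x mod N) 0 < q (y mod N) 0" if "x \<in> C" "y \<in> C" "x div N = y div N" for x y
      proof
        assume *: "q (x mod N) 0 < q (y mod N) 0"
        then have "p' x 0 < p' y 0" using that less by (simp add: p'_less_iff s_def)
        then have "p' x 1 < p' y 0" using T[of x y 1 0] that True Suc.hyps by simp
        then show False using that less q_less[of 0 "y mod N"] dm Suc.hyps
          by (auto simp: p'_less_iff s_def)
      qed
      show ?thesis
      proof (rule card_le_by_div[OF C])
        fix x y assume xy: "x \<in> C" "y \<in> C" "x \<noteq> y"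
        show "x div N \<noteq> y div N"
        proof
          assume eq: "x div N = y div N"
          then have "q (x mod N) 0 = q (y mod N) 0" using same xy by (metis linorder_neqE)
          then have "x mod N = y mod N" using q_inj dm less xy by blast
          then show False using eq xy div_mod_eq_imp_eq by blast
        qed
      next
        assume sub: "(\<lambda>z. z div N) ` C \<subseteq> {..<K}"
        have "p a i < p b j \<longleftrightarrow> T (Suc i) (Suc j)"
          if ab: "a \<in> (\<lambda>z. z div N) ` C" "b \<in> (\<lambda>z. z div N) ` C" "a \<noteq> b" "p a 0 < p b 0" "i < r" "j < r" for a b i j
        proof -
          from ab obtain x y where xy: "x \<in> C" "y \<in> C" "a = x div N" "b = y div N" by auto
          have "p' x 0 < p' y 0" using xy ab less by (simp add: p'_less_iff)
          then have "p' x (Suc i) < p' y (Suc j) \<longleftrightarrow> T (Suc i) (Suc j)" using T[of x y "Suc i" "Suc j"] xy ab by simp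
          moreover have "a < K" "b < K" using ab sub by auto
          then have "p a i \<noteq> p b j" using p_inj ab by blast
          ultimately show ?thesis using xy ab less by (simp add: p'_less_iff)
        qed
        then have "homogeneous r p ((\<lambda>z. z div N) ` C)"
          unfolding homogeneous_def by (intro exI[of _ "\<lambda>i j. T (Suc i) (Suc j)"]) blast
        then show "card ((\<lambda>z. z div N) ` C) \<le> m" by (rule p_card[OF sub])
      qed
    next
      case False
      have same: "\<not> p (x div N) 0 < p (y div N) 0" if "x \<in> C" "y \<in> C" for x y
      proof
        assume *: "p (x div N) 0 < p (y div N) 0"
        then have "p' x 0 < p' y 0" "p' x 1 < p' y 0"
          using that less Suc.hyps by (auto simp: p'_less_iff)
        then show False using T[of x y 1 0] that False Suc.hyps by simp
      qed
      have eq: "x div N = y div N" if "x \<in> C" "y \<in> C" for x y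
        using same that p_inj[of "x div N" "y div N" 0 0] dm less Suc.hyps
        by (metis One_nat_def Suc_le_lessD linorder_neqE)
      show ?thesis
      proof (rule card_le_by_mod[OF C eq])
        assume sub: "(\<lambda>z. z mod N) ` C \<subseteq> {..<N}"
        show "card ((\<lambda>z. z mod N) ` C) \<le> m"
        proof (rule q_card[OF sub])
          fix a b i assume ab: "a \<in> (\<lambda>z. z mod N) ` C" "b \<in> (\<lambda>z. z mod N) ` C" "q a 0 < q b 0" "i \<le> r"
          then obtain x y where xy: "x \<in> C" "y \<in> C" "a = x mod N" "b = y mod N" by auto
          have "p' x 0 < p' y 0" using xy ab less eq[of x y] by (simp add: p'_less_iff s_def)
          then have "p' x i < p' y i \<longleftrightarrow> T i i" using T[of x y i i] xy ab by simp
          then show "q a i < q b i \<longleftrightarrow> T i i"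
            using xy ab less eq[of x y] by (simp add: p'_less_iff s_def)
        qed
      qed
    qed
  qed
  show ?case
    unfolding KN
    by (intro exI[of _ p'] conjI allI impI) (use 1 2 3 in \<open>auto 0 3\<close>)
qed

lemma extremal_matching:
  assumes r: "1 \<le> r" and n: "n \<le> m ^ (2 ^ r - 1)"
  shows "\<exists>M :: nat hypergraph. is_matching r M \<and> msize M = n \<and> largest_clique r M \<le> m"
proof -
  define N where "N = m ^ (2 ^ r - 1)"
  obtain p :: "nat \<Rightarrow> nat \<Rightarrow> nat" where p:
    "\<forall>x<N. \<forall>i j. i < j \<longrightarrow> j < r \<longrightarrow> p x i < p x j"
    "\<forall>x<N. \<forall>y<N. \<forall>i<r. \<forall>j<r. p x i = p y j \<longrightarrow> x = y"
    "\<forall>C\<subseteq>{..<N}. homogeneous r p C \<longrightarrow> card C \<le> m"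
    using extremal_family[OF r, of m] unfolding N_def by blast
  have mono: "p x i < p x j" if "x < N" "i < j" "j < r" for x i j
    using p(1) that by blast
  have inj: "x = y" if "x < N" "y < N" "i < r" "j < r" "p x i = p y j" for x y i j
    using p(2) that by blast
  have hom: "card C \<le> m" if "C \<subseteq> {..<N}" "homogeneous r p C" for C
    using p(3) that by blast
  define edge where "edge x = p x ` {..<r}" for x
  define F where "F = edge ` {..<n}"
  have nN: "x < N" if "x < n" for x using n that by (simp add: N_def)
  have vertex_edge: "vertex (edge x) i = p x i" if "x < n" "i < r" for x i
    unfolding edge_def by (rule vertex_image_enum) (use that mono nN in auto)
  have card_edge: "card (edge x) = r" if "x < n" for x
  proof -
    have "inj_on (p x) {..<r}"
    proof (rule linorder_inj_onI)
      fix i j assume "i < j" "j \<in> {..<r}"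
      then show "p x i \<noteq> p x j" using mono[OF nN[OF that]] by force
    qed auto
    then show ?thesis by (simp add: edge_def card_image)
  qed
  have dis: "edge x \<inter> edge y = {}" if "x < n" "y < n" "x \<noteq> y" for x y
    using inj nN that by (auto simp: edge_def)
  have inj_edge: "inj_on edge {..<n}"
  proof (rule inj_onI, rule ccontr)
    fix x y assume "x \<in> {..<n}" "y \<in> {..<n}" "edge x = edge y" "x \<noteq> y"
    then have "edge x = {}" using dis[of x y] by simp
    then show False using card_edge[of x] \<open>x \<in> {..<n}\<close> r by simp
  qed
  have M: "is_matching r (spanned F)"
  proof (subst is_matching_spanned_iff)
    have "pairwise disjnt F"
    proof (rule pairwiseI)
      fix e f assume "e \<in> F" "f \<in> F" "e \<noteq> f"
      then obtain x y where "x < n" "y < n" "e = edge x" "f = edge y" by (auto simp: F_def)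
      with \<open>e \<noteq> f\<close> show "disjnt e f" using dis[of x y] by (auto simp: disjnt_def)
    qed
    moreover have "finite (edge x)" for x by (simp add: edge_def)
    ultimately show "finite (\<Union>F) \<and> (\<forall>e\<in>F. card e = r) \<and> pairwise disjnt F"
      using card_edge by (auto simp: F_def)
  qed (use r in simp)
  moreover have "msize (spanned F) = n"
    using inj_edge by (simp add: msize_def spanned_def F_def card_image)
  moreover have "largest_clique r (spanned F) \<le> m"
  proof (rule largest_clique_le[OF M])
    fix F' assume "F' \<subseteq> edges (spanned F)" and F': "homogeneous r vertex F'"
    then obtain C where C: "C \<subseteq> {..<n}" "F' = edge ` C"
      by (auto simp: spanned_def F_def subset_image_iff)
    from F' obtain T where T: "\<forall>e\<in>F'. \<forall>f\<in>F'. e \<noteq> f \<longrightarrow> vertex e 0 < vertex f 0 \<longrightarrow>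
        (\<forall>i<r. \<forall>j<r. vertex e i < vertex f j \<longleftrightarrow> T i j)"
      unfolding homogeneous_def ..
    have "p x i < p y j \<longleftrightarrow> T i j"
      if xy: "x \<in> C" "y \<in> C" "p x 0 < p y 0" and ij: "i < r" "j < r" for x y i j
    proof -
      have n: "x < n" "y < n" using xy C by auto
      have "edge x \<noteq> edge y" using inj_edge n xy(3) by (auto dest: inj_onD)
      then show ?thesis using T[rule_format, of "edge x" "edge y" i j] n xy ij C vertex_edge by auto
    qed
    then have "homogeneous r p C" unfolding homogeneous_def by blast
    moreover have "C \<subseteq> {..<N}" using C(1) nN by auto
    ultimately have "card C \<le> m" by (intro hom)
    moreover have "card F' = card C"
      unfolding C(2) using inj_on_subset[OF inj_edge C(1)] by (rule card_image)
    ultimately show "card F' \<le> m" by simp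
  qed (use r in simp)
  ultimately show ?thesis by blast
qed

section \<open>The two bounds\<close>

theorem theorem1p7:
  fixes r n :: nat
  assumes "r \<ge> 2" and "n \<ge> 1"
  shows "1 / (real r - 1) * real n powr (1 / ((real r + 1) * 2 ^ (r - 2)))
           \<le> real (min_largest_clique r n)
       \<and> int (min_largest_clique r n) \<le> \<lceil>real n powr (1 / (2 ^ r - 1))\<rceil>"
proof
  define S where "S = {largest_clique r M | M :: nat hypergraph. is_matching r M \<and> msize M = n}"
  have L: "min_largest_clique r n = Inf S" by (simp add: min_largest_clique_def S_def)
  have S: "\<exists>l\<in>S. l \<le> m" if "n \<le> m ^ (2 ^ r - 1)" for m
    using extremal_matching[OF _ that] assms(1) unfolding S_def by force
  \<comment> \<open>The set of values must be shown nonempty, since the infimum of the empty set would be \<open>0\<close>.\<close>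
  have "(1::nat) \<le> 2 ^ r - 1"
    using power_increasing[of 1 r "2::nat"] assms(1) by simp
  then have "n \<le> n ^ (2 ^ r - 1)" using power_increasing[of 1 "2 ^ r - 1" n] assms(2) by simp
  from S[OF this] have "S \<noteq> {}" by blast
  then have "min_largest_clique r n \<in> S" unfolding L by (rule Inf_nat_def1)
  then obtain M :: "nat hypergraph" where
    M: "is_matching r M" "msize M = n" "largest_clique r M = min_largest_clique r n"
    unfolding S_def by auto
  define D where "D = (r + 1) * 2 ^ (r - 2)"
  have D: "0 < D" "real D = (real r + 1) * 2 ^ (r - 2)" by (auto simp: D_def algebra_simps)
  define k where "k = (r - 1) * min_largest_clique r n"
  have "n \<le> k ^ D"
    using msize_le_largest_clique_power[OF M(1) assms(1)] M by (simp add: D_def k_def)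
  then have "real n \<le> real k ^ D" by (metis of_nat_le_iff of_nat_power)
  moreover have "0 < k" using \<open>n \<le> k ^ D\<close> assms(2) D(1) by (cases k) (auto simp: zero_power)
  ultimately have "real n powr (1 / real D) \<le> (real k ^ D) powr (1 / real D)"
    by (intro powr_mono2) auto
  also have "\<dots> = real k"
    using \<open>0 < k\<close> D(1) by (simp add: powr_powr flip: powr_realpow)
  finally have "real n powr (1 / real D) \<le> (real r - 1) * real (min_largest_clique r n)"
    using assms(1) by (simp add: k_def of_nat_diff)
  then show "1 / (real r - 1) * real n powr (1 / ((real r + 1) * 2 ^ (r - 2)))
           \<le> real (min_largest_clique r n)"
    using assms(1) unfolding D(2) by (simp add: field_simps)
  define m where "m = nat \<lceil>real n powr (1 / (2 ^ r - 1))\<rceil>"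
  define E :: nat where "E = 2 ^ r - 1"
  have E: "real E = 2 ^ r - 1" "0 < E" using \<open>1 \<le> 2 ^ r - 1\<close> by (auto simp: E_def of_nat_diff)
  have "real n = (real n powr (1 / real E)) ^ E"
    using assms(2) E(2) by (simp add: powr_powr flip: powr_realpow)
  also have "\<dots> \<le> real m ^ E"
    unfolding m_def E(1) by (intro power_mono) (auto simp: of_nat_ceiling)
  finally have "n \<le> m ^ E" by (metis of_nat_le_iff of_nat_power)
  then obtain l where "l \<in> S" "l \<le> m" using S unfolding E_def by blast
  then have "min_largest_clique r n \<le> m" unfolding L using wellorder_Inf_le1[of l S] by simp
  moreover have "0 \<le> \<lceil>real n powr (1 / (2 ^ r - 1))\<rceil>"
    unfolding zero_le_ceiling using powr_ge_zero[of "real n" "1 / (2 ^ r - 1)"] by linarith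
  ultimately show "int (min_largest_clique r n) \<le> \<lceil>real n powr (1 / (2 ^ r - 1))\<rceil>"
    unfolding m_def by linarith
qed

end
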